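(* Let $q=2^m$ with $m$ a positive integer, let $n$ be a positive integer, let $k$ and $l$ be nonnegative integers, and let $a\in\mathbb F_{q^n}^*$. Put $d=\gcd(l-1,m)$. Then $ax^{2^lq^k}+x\mathrm{Tr}(x)$ is a permutation polynomial of $\mathbb F_{q^n}$ if and only if $n$ is odd, $\gcd\big(2^{l+mk}-1,(q^n-1)/(q-1)\big)=1$, and $a\in\mathbb F_q^*$ with $a^{(q-1)/(2^d-1)}\ne1$.
   Context: $\mathrm{Tr}$ is the trace map of $\mathbb F_{q^n}/\mathbb F_q$, so $\mathrm{Tr}(x)=\sum_{i=0}^{n-1}x^{q^i}$. A permutation polynomial of $\mathbb F_{q^n}$ is a polynomial over $\mathbb F_{q^n}$ whose induced map on $\mathbb F_{q^n}$ is a bijection. Greatest common divisors are of integers, taken nonnegative, with $\gcd(0,N)=N$ for $N>0$. *)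

theory Defs
  imports "HOL-Computational_Algebra.Polynomial"
begin

definition is_subfield :: "'a::field set \<Rightarrow> bool" where
  "is_subfield K \<longleftrightarrow>
     0 \<in> K \<and> 1 \<in> K \<and>
     (\<forall>x\<in>K. \<forall>y\<in>K. x - y \<in> K \<and> x * y \<in> K) \<and>
     (\<forall>x\<in>K. inverse x \<in> K)"

(* Tr(X) = X + X^q + ... + X^(q^(n-1)); it induces the trace map when the
   ambient field has q^n elements. *)
definition trace_poly :: "nat \<Rightarrow> nat \<Rightarrow> 'a::comm_semiring_1 poly" where
  "trace_poly q n = (\<Sum>i<n. monom 1 (q ^ i))"

definition permutation_poly :: "'a::comm_semiring_0 poly \<Rightarrow> bool" where
  "permutation_poly p \<longleftrightarrow> bij (poly p)"

end

theory Submission imports Defs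
begin

text \<open>
  Let \<open>f x = a * x ^ Q + x * Tr x\<close> with \<open>Q = 2 ^ (l + m * k)\<close>. Since \<open>f\<close> is quadratic in
  characteristic 2, it is injective iff for no \<open>u \<noteq> 0\<close> the value \<open>f u\<close> lies in the image of
  the linear map \<open>x \<mapsto> x * Tr u + u * Tr x\<close>. That image is \<open>u K\<close> if \<open>Tr u = 0\<close>, and the kernel
  of the trace otherwise. So \<open>f\<close> permutes the field iff \<open>a * u ^ (Q - 1) \<notin> K\<close> whenever
  \<open>u \<noteq> 0\<close> and \<open>Tr u = 0\<close>, and \<open>Tr (a * u ^ Q) \<noteq> (Tr u)\<^sup>2\<close> whenever \<open>Tr u \<noteq> 0\<close>. Writing
  \<open>a = b ^ Q\<close>, the second condition says that \<open>Tr (b * u) ^ Q \<noteq> (Tr u)\<^sup>2\<close>; it forces \<open>b \<in> K\<close>, because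
  otherwise \<open>Tr u\<close> and \<open>Tr (b * u)\<close> can be prescribed independently, and for \<open>a \<in> K\<close> it
  says that \<open>a * t ^ 2 ^ l = t\<^sup>2\<close> has no solution \<open>t \<noteq> 0\<close> in \<open>K\<close>. The first condition gives \<open>n\<close>
  odd (take \<open>u = 1\<close>) and the condition on the greatest common divisor.
\<close>

section \<open>Exponent arithmetic and bounds on numbers of roots\<close>

lemma gcd_two_power_minus_1: "gcd (2 ^ a - 1) (2 ^ b - 1) = 2 ^ gcd a b - (1::nat)"
proof (induction "a + b" arbitrary: a b rule: less_induct)
  case less
  \<comment> \<open>Euclid's algorithm runs on the exponents: passing from \<open>a\<close> to
    \<open>a - b\<close> replaces \<open>2 ^ a - 1\<close> by its remainder after removing a
    multiple of \<open>2 ^ b - 1\<close>.\<close>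
  have step: "gcd (2 ^ a - 1) (2 ^ b - 1) = 2 ^ gcd a b - (1::nat)"
    if "b \<le> a" "b > 0" and IH: "gcd (2 ^ (a - b) - 1) (2 ^ b - 1) = 2 ^ gcd (a - b) b - (1::nat)"
    for a b :: nat
  proof -
    have "(2::nat) ^ a = 2 ^ (a - b) * 2 ^ b"
      using that by (simp flip: power_add)
    then have "(2::nat) ^ a - 1 = 2 ^ (a - b) * (2 ^ b - 1) + (2 ^ (a - b) - 1)"
      by (simp add: diff_mult_distrib2)
    then have "gcd (2 ^ a - 1) (2 ^ b - 1) = gcd (2 ^ (a - b) - 1) (2 ^ b - (1::nat))"
      by (metis gcd.commute gcd_add_mult mult.commute add.commute)
    moreover have "gcd (a - b) b = gcd a b"
      using that by (metis gcd.commute gcd_diff1_nat)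
    ultimately show ?thesis
      using IH by simp
  qed
  consider "a = 0" | "b = 0" | "b \<le> a" "b > 0" | "a \<le> b" "a > 0"
    by linarith
  then show ?case
  proof cases
    case 3
    then show ?thesis
      using less[of "a - b" b] step[of b a] by simp
  next
    case 4
    then show ?thesis
      using less[of "b - a" a] step[of a b] by (simp add: gcd.commute)
  qed simp_all
qed

lemma power_gcd_eq_1:
  fixes x :: "'a::field"
  assumes "x ^ i = 1" "x ^ j = 1"
  shows "x ^ gcd i j = 1"
proof (cases "i = 0")
  case False
  then obtain s t where "i * s = j * t + gcd i j"
    using bezout_nat by blast
  then have "(x ^ i) ^ s = (x ^ j) ^ t * x ^ gcd i j"
    by (simp flip: power_mult power_add)
  then show ?thesis
    using assms by simp
qed (use assms in simp)

lemma power_diff_1_mult: "0 < n \<Longrightarrow> x ^ (n - 1) * x = (x ^ n :: 'a::monoid_mult)"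
  by (metis Suc_diff_1 power_Suc2)

lemma card_nth_roots_le:
  fixes c :: "'a::{field,finite}"
  assumes "f > 0"
  shows "card {x. x ^ f = c} \<le> f"
proof -
  let ?p = "monom 1 f + [:- c:]"
  have "degree ?p = f"
    using assms by (subst degree_add_eq_left) (auto simp: degree_monom_eq)
  moreover have "?p \<noteq> 0"
    using calculation assms by (metis degree_0 less_irrefl)
  moreover have "{x. poly ?p x = 0} = {x. x ^ f = c}"
    by (simp add: poly_monom)
  ultimately show ?thesis
    using card_poly_roots_bound[of ?p] by simp
qed

section \<open>Subfields of a finite field and their power maps\<close>

context
  fixes K :: "'a::{field,finite} set"
  assumes subfield: "is_subfield K"
begin

lemma subfield_0 [simp]: "0 \<in> K" and subfield_1 [simp]: "1 \<in> K"
  and subfield_diff: "x \<in> K \<Longrightarrow> y \<in> K \<Longrightarrow> x - y \<in> K"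
  and subfield_mult: "x \<in> K \<Longrightarrow> y \<in> K \<Longrightarrow> x * y \<in> K"
  and subfield_inverse: "x \<in> K \<Longrightarrow> inverse x \<in> K"
  using subfield by (auto simp: is_subfield_def)

lemma subfield_power: "x \<in> K \<Longrightarrow> x ^ i \<in> K"
  by (induction i) (auto simp: subfield_mult)

lemma subfield_mult_iff: "a \<in> K \<Longrightarrow> a \<noteq> 0 \<Longrightarrow> a * x \<in> K \<longleftrightarrow> x \<in> K"
proof
  assume "a \<in> K" "a \<noteq> 0" "a * x \<in> K"
  then have "inverse a * (a * x) \<in> K"
    by (simp only: subfield_mult subfield_inverse)
  moreover have "inverse a * (a * x) = x"
    using \<open>a \<noteq> 0\<close> by (simp add: field_simps)
  ultimately show "x \<in> K"
    by simp
qed (simp add: subfield_mult)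

lemma card_subfield_gt_1: "card K > 1"
  using card_mono[of K "{0,1}"] by simp

text \<open>Multiplication by \<open>c\<close> permutes the nonzero elements of \<open>K\<close>, so
  their product gains the factor \<open>c ^ (card K - 1)\<close> and yet stays the same.\<close>

lemma subfield_power_card_minus_1:
  assumes "c \<in> K" "c \<noteq> 0"
  shows "c ^ (card K - 1) = 1"
proof -
  let ?G = "K - {0}"
  have inj: "inj_on ((*) c) ?G"
    using assms by (auto simp: inj_on_def)
  have "(*) c ` ?G \<subseteq> ?G"
    using assms by (auto simp: subfield_mult)
  then have "(*) c ` ?G = ?G"
    using inj by (intro card_subset_eq) (auto simp: card_image)
  then have "\<Prod>?G = (\<Prod>x\<in>?G. c * x)"
    using prod.reindex[OF inj, of "\<lambda>x. x"] by simp
  also have "\<dots> = c ^ card ?G * \<Prod>?G"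
    by (simp add: prod.distrib)
  finally show ?thesis
    by simp
qed

lemma subfield_power_card:
  assumes "c \<in> K"
  shows "c ^ card K = c"
  using subfield_power_card_minus_1[OF assms] card_subfield_gt_1 power_diff_1_mult[of "card K" c]
  by (cases "c = 0") auto

text \<open>By counting: a fixed point other than \<open>0\<close> solves
  \<open>x ^ (card K - 1) = 1\<close>, which leaves no room for one outside
  \<open>K\<close>.\<close>

lemma subfield_eq_power_fixed: "K = {x. x ^ card K = x}"
proof (rule card_seteq)
  show "K \<subseteq> {x. x ^ card K = x}"
    using subfield_power_card by blast
  have "{x. x ^ card K = x} \<subseteq> insert 0 {x. x ^ (card K - 1) = (1::'a)}"
  proof
    fix x :: 'a
    assume "x \<in> {x. x ^ card K = x}"
    then have "x ^ (card K - 1) * x = x"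
      using card_subfield_gt_1 power_diff_1_mult[of "card K" x] by simp
    then show "x \<in> insert 0 {x. x ^ (card K - 1) = 1}"
      by simp
  qed
  then have "card {x. x ^ card K = (x::'a)} \<le> card (insert 0 {x. x ^ (card K - 1) = (1::'a)})"
    by (intro card_mono) auto
  also have "\<dots> \<le> Suc (card K - 1)"
    using card_nth_roots_le[of "card K - 1" "1::'a"] card_subfield_gt_1
    by (intro order_trans[OF card_insert_le_m1]) auto
  finally show "card {x. x ^ card K = (x::'a)} \<le> card K"
    using card_subfield_gt_1 by simp
qed simp

text \<open>A substitute for cyclicity of the multiplicative group: every fibre of
  \<open>x \<mapsto> x ^ e\<close> has at most \<open>e\<close> points, so its image fills the at most \<open>f\<close>
  solutions of \<open>x ^ f = 1\<close>.\<close>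

lemma
  assumes ef: "e * f = card K - 1"
  shows subfield_power_image: "(\<lambda>x. x ^ e) ` (K - {0}) = {x \<in> K. x ^ f = 1}"
    and card_subfield_roots_of_unity: "card {x \<in> K. x ^ f = 1} = f"
proof -
  let ?G = "K - {0}" and ?R = "{x \<in> K. x ^ f = 1}"
  let ?P = "(\<lambda>x. x ^ e) ` ?G"
  have pos: "e > 0" "f > 0"
    using ef card_subfield_gt_1 by (cases e; cases f; simp)+
  have sub: "?P \<subseteq> ?R"
  proof safe
    fix x
    assume "x \<in> K" "x \<noteq> 0"
    then show "(x ^ e) ^ f = 1"
      using subfield_power_card_minus_1[of x] ef by (simp flip: power_mult)
  qed (rule subfield_power)
  have R: "card ?R \<le> f"
    by (rule order_trans[OF card_mono card_nth_roots_le[OF pos(2), of "1::'a"]]) auto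
  have "?G = (\<Union>y\<in>?P. {x \<in> ?G. x ^ e = y})"
    by auto
  then have "card ?G \<le> (\<Sum>y\<in>?P. card {x \<in> ?G. x ^ e = y})"
    using card_UN_le[of ?P "\<lambda>y. {x \<in> ?G. x ^ e = y}"] by simp
  also have "\<dots> \<le> (\<Sum>y\<in>?P. e)"
    by (intro sum_mono order_trans[OF card_mono card_nth_roots_le[OF pos(1)]]) auto
  finally have "e * f \<le> e * card ?P"
    using ef by (simp add: mult.commute)
  then have P: "f \<le> card ?P"
    using pos by simp
  show "?P = ?R"
    using sub P R by (intro card_seteq) auto
  then show "card ?R = f"
    using P R by simp
qed

text \<open>By Bezout, the exponents \<open>E\<close> and \<open>gcd E (card K - 1)\<close> give the
  same image on the nonzero elements of \<open>K\<close>; the gcd divides \<open>card K - 1\<close>,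
  so its image is known.\<close>

lemma subfield_power_image_iff:
  assumes c: "c \<in> K" "c \<noteq> 0"
  shows "(\<exists>t\<in>K - {0}. t ^ E = c) \<longleftrightarrow> c ^ ((card K - 1) div gcd E (card K - 1)) = 1"
proof -
  let ?N = "card K - 1"
  let ?e = "gcd E ?N"
  have im: "(\<lambda>x. x ^ ?e) ` (K - {0}) = {x \<in> K. x ^ (?N div ?e) = 1}"
    by (rule subfield_power_image) simp
  have "(\<exists>t\<in>K - {0}. t ^ E = c) \<longleftrightarrow> (\<exists>t\<in>K - {0}. t ^ ?e = c)"
  proof -
    have "\<exists>s\<in>K - {0}. s ^ ?e = t ^ E" if t: "t \<in> K" "t \<noteq> 0" for t
    proof -
      have "t ^ E = (t ^ (E div ?e)) ^ ?e"
        by (simp flip: power_mult)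
      then show ?thesis
        using t by (intro bexI[of _ "t ^ (E div ?e)"]) (auto simp: subfield_power)
    qed
    moreover have "\<exists>s\<in>K - {0}. s ^ E = t ^ ?e" if t: "t \<in> K" "t \<noteq> 0" for t
    \<comment> \<open>Bezout over the naturals needs \<open>E\<close> nonzero; for
      \<open>E = 0\<close> both powers are \<open>1\<close>.\<close>
    proof (cases "E = 0")
      case True
      then show ?thesis
        using t subfield_power_card_minus_1 by (intro bexI[of _ 1]) auto
    next
      case False
      then obtain x y where "E * x = ?N * y + ?e"
        using bezout_nat by blast
      then have "(t ^ x) ^ E = (t ^ ?N) ^ y * t ^ ?e"
        by (simp add: ac_simps flip: power_mult power_add)
      then show ?thesis
        using t subfield_power_card_minus_1[OF t]
        by (intro bexI[of _ "t ^ x"]) (auto simp: subfield_power)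
    qed
    ultimately show ?thesis
      by (metis DiffE singletonI)
  qed
  also have "\<dots> \<longleftrightarrow> c \<in> (\<lambda>x. x ^ ?e) ` (K - {0})"
    by auto
  finally show ?thesis
    using c im by simp
qed

end

lemma is_subfield_UNIV: "is_subfield UNIV"
  by (simp add: is_subfield_def)

section \<open>Arithmetic in characteristic 2\<close>

locale even_field_extension =
  fixes K :: "'a::{field,finite} set" and m n q :: nat
  assumes m_pos: "m > 0" and n_pos: "n > 0" and q_def: "q = 2 ^ m"
    and card_UNIV: "card (UNIV :: 'a set) = q ^ n"
    and subfield: "is_subfield K" and card_K: "card K = q"
begin

lemmas [simp] = subfield_0[OF subfield] subfield_1[OF subfield]
lemmas K_mult = subfield_mult[OF subfield]
lemmas K_power = subfield_power[OF subfield]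
lemmas K_inverse = subfield_inverse[OF subfield]
lemmas K_mult_iff = subfield_mult_iff[OF subfield]

lemma q_gt_1: "q > 1"
  using card_subfield_gt_1[OF subfield] card_K by simp

lemma power_card_UNIV: "x ^ (q ^ n) = (x::'a)"
  using subfield_power_card[OF is_subfield_UNIV, of x] card_UNIV by simp

text \<open>The characteristic is read off from the even cardinality: \<open>(- 1) ^ (q ^ n)\<close>
  is both \<open>1\<close> and \<open>- 1\<close>.\<close>

lemma minus_eq [simp]: "- x = (x::'a)"
proof -
  have "even (q ^ n)"
    using m_pos n_pos by (simp add: q_def)
  then have "(- 1) ^ (q ^ n) = (1::'a)"
    by simp
  then have "- 1 = (1::'a)"
    using power_card_UNIV by metis
  then show ?thesis
    by (metis mult_minus1 mult_1)
qed

lemma add_self [simp]: "x + x = (0::'a)"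
  using minus_eq add.right_inverse by metis

lemma diff_eq_add: "x - y = x + (y::'a)"
  by (metis minus_eq diff_conv_add_uminus)

lemma add_eq_0_iff_eq: "x + y = 0 \<longleftrightarrow> x = (y::'a)"
  by (metis diff_eq_add right_minus_eq)

lemma power_2_power_add: "(x + y) ^ (2 ^ i) = x ^ (2 ^ i) + (y::'a) ^ (2 ^ i)"
proof (induction i)
  case (Suc i)
  have "(u + v)\<^sup>2 = u\<^sup>2 + v\<^sup>2" for u v :: 'a
  proof -
    have "(u + v)\<^sup>2 = u\<^sup>2 + v\<^sup>2 + (u * v + u * v)"
      by (simp add: power2_eq_square algebra_simps del: add_self)
    then show ?thesis
      by simp
  qed
  then show ?case
    using Suc by (simp add: power_mult mult.commute[of 2])
qed simp

lemma power_q_power_add: "(x + y) ^ (q ^ i) = x ^ (q ^ i) + (y::'a) ^ (q ^ i)"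
  using power_2_power_add[of x y "m * i"] by (simp add: q_def power_mult)

lemma mem_K_iff: "x \<in> K \<longleftrightarrow> x ^ q = x"
  using subfield_eq_power_fixed[OF subfield] card_K by auto

lemma mem_K_iff_power_eq_1: "x \<noteq> 0 \<Longrightarrow> x \<in> K \<longleftrightarrow> x ^ (q - 1) = 1"
  using power_diff_1_mult[of q x] q_gt_1 by (metis mem_K_iff less_trans zero_less_one mult_cancel_right1 mult.commute)

lemma K_power_q_power: "x \<in> K \<Longrightarrow> x ^ (q ^ i) = x"
  by (induction i) (simp_all add: mem_K_iff power_mult)

lemma K_add: "x \<in> K \<Longrightarrow> y \<in> K \<Longrightarrow> x + y \<in> K"
  using subfield_diff[OF subfield] by (simp add: diff_eq_add)

section \<open>The trace onto \<open>K\<close>\<close>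

definition Tr :: "'a \<Rightarrow> 'a" where
  "Tr x = (\<Sum>i<n. x ^ (q ^ i))"

lemma poly_trace_poly: "poly (trace_poly q n) = Tr"
  by (auto simp: trace_poly_def Tr_def poly_sum poly_monom)

lemma Tr_add: "Tr (x + y) = Tr x + Tr y"
  by (simp add: Tr_def power_q_power_add sum.distrib)

lemma Tr_0 [simp]: "Tr 0 = 0"
  using q_gt_1 by (simp add: Tr_def power_0_left)

lemma Tr_mult: "c \<in> K \<Longrightarrow> Tr (c * x) = c * Tr x"
  by (simp add: Tr_def power_mult_distrib K_power_q_power sum_distrib_left)

lemma Tr_mult': "c \<in> K \<Longrightarrow> Tr (x * c) = Tr x * c"
  using Tr_mult[of c x] by (simp add: mult.commute)

lemma power_2_power_sum: "finite A \<Longrightarrow> (\<Sum>i\<in>A. g i) ^ (2 ^ j) = (\<Sum>i\<in>A. (g i :: 'a) ^ (2 ^ j))"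
  by (induction A rule: finite_induct) (simp_all add: power_2_power_add)

lemma Tr_power_2_power: "Tr (x ^ (2 ^ j)) = Tr x ^ (2 ^ j)"
  unfolding Tr_def by (simp add: power_2_power_sum power_mult[symmetric] mult.commute)

text \<open>Raising to the power \<open>q\<close> shifts the summands, and
  \<open>x ^ (q ^ n) = x\<close> closes the cycle: adding \<open>x\<close> to
  \<open>Tr x ^ q\<close> or to \<open>Tr x\<close> gives the same sum of \<open>n + 1\<close>
  terms.\<close>

lemma Tr_in_K: "Tr x \<in> K"
proof -
  have "Tr x ^ q = (\<Sum>i<n. x ^ (q ^ Suc i))"
    using power_2_power_sum[of "{..<n}" "\<lambda>i. x ^ (q ^ i)" m]
    by (simp add: Tr_def mult.commute flip: q_def power_mult)
  also have "\<dots> + x = (\<Sum>i<Suc n. x ^ (q ^ i))"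
    by (subst sum.lessThan_Suc_shift) (simp add: add.commute)
  also have "\<dots> = Tr x + x"
    by (simp add: Tr_def power_card_UNIV)
  finally show ?thesis
    by (simp add: mem_K_iff)
qed

text \<open>The trace polynomial is nonzero of degree at most \<open>q ^ (n - 1)\<close>, so it
  cannot vanish at all \<open>q ^ n\<close> elements.\<close>

lemma Tr_nonzero: "\<exists>x. Tr x \<noteq> 0"
proof (rule ccontr)
  assume *: "\<nexists>x. Tr x \<noteq> 0"
  obtain n' where n': "n = Suc n'"
    using n_pos gr0_implies_Suc by blast
  let ?p = "trace_poly q n :: 'a poly"
  have "coeff ?p (q ^ n') = (\<Sum>i<n. if i = n' then 1 else 0)"
    using q_gt_1 by (auto simp: trace_poly_def coeff_sum intro!: sum.cong)
  then have "?p \<noteq> 0"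
    using n' by (auto simp: sum.delta)
  then have "card {x. poly ?p x = 0} \<le> degree ?p"
    by (rule card_poly_roots_bound)
  moreover have "degree ?p \<le> q ^ n'"
    unfolding trace_poly_def
    using q_gt_1 n' by (intro degree_sum_le) (auto simp: degree_monom_eq)
  moreover have "{x. poly ?p x = 0} = UNIV"
    using * by (simp add: poly_trace_poly)
  ultimately have "q ^ n \<le> q ^ n'"
    using card_UNIV by simp
  then show False
    using q_gt_1 n' by simp
qed

lemma Tr_surj:
  assumes "c \<in> K"
  obtains x where "Tr x = c"
proof -
  obtain y where y: "Tr y \<noteq> 0"
    using Tr_nonzero by blast
  have "Tr (c * inverse (Tr y) * y) = c"
    using y assms by (subst Tr_mult) (auto intro!: K_mult K_inverse Tr_in_K)
  then show thesis
    using that by blast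
qed

lemma Tr_nondegenerate:
  assumes "\<And>v. Tr (c * v) = 0"
  shows "c = 0"
proof (rule ccontr)
  assume "c \<noteq> 0"
  then have "Tr v = 0" for v
    using assms[of "v / c"] by simp
  then show False
    using Tr_nonzero by simp
qed

text \<open>Otherwise the kernel of \<open>v \<mapsto> Tr (b * v)\<close> lies in that of
  \<open>Tr\<close>, so the two functionals are proportional over \<open>K\<close>, and
  nondegeneracy puts \<open>b\<close> into \<open>K\<close>.\<close>

lemma ex_Tr_separating:
  assumes "b \<notin> K"
  shows "\<exists>v. Tr (b * v) = 0 \<and> Tr v = 1"
proof -
  have "\<exists>v. Tr (b * v) = 0 \<and> Tr v \<noteq> 0"
  proof (rule ccontr)
    assume "\<not> ?thesis"
    then have ker: "Tr (b * v) = 0 \<Longrightarrow> Tr v = 0" for v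
      by blast
    have "b \<noteq> 0"
      using assms by auto
    obtain w where "Tr w = 1"
      using Tr_surj subfield_1[OF subfield] by blast
    then obtain z where z: "Tr (b * z) = 1"
      using \<open>b \<noteq> 0\<close> by (metis nonzero_mult_div_cancel_left times_divide_eq_right)
    have "Tr ((1 + Tr z * b) * v) = 0" for v
    proof -
      \<comment> \<open>As \<open>Tr (b * z) = 1\<close>, this correction of \<open>v\<close> by a
        multiple of \<open>z\<close> projects it into the kernel of
        \<open>v \<mapsto> Tr (b * v)\<close>.\<close>
      have "Tr (b * (v + Tr (b * v) * z)) = Tr (b * v) + Tr (Tr (b * v) * (b * z))"
        by (simp add: distrib_left Tr_add mult.left_commute)
      also have "\<dots> = 0"
        by (simp add: Tr_mult Tr_in_K z)
      finally have "Tr (v + Tr (b * v) * z) = 0"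
        by (rule ker)
      then show ?thesis
        by (simp add: distrib_right Tr_add Tr_mult Tr_in_K mult.assoc) (simp add: mult.commute)
    qed
    then have "1 + Tr z * b = 0"
      by (rule Tr_nondegenerate)
    then have "Tr z * b = 1"
      by (metis add_eq_0_iff_eq)
    then have "inverse (Tr z) = b"
      by (rule inverse_unique)
    then show False
      using assms K_inverse[OF Tr_in_K] by metis
  qed
  then obtain v where v: "Tr (b * v) = 0" "Tr v \<noteq> 0"
    by blast
  let ?v = "inverse (Tr v) * v"
  have c: "inverse (Tr v) \<in> K"
    by (intro K_inverse Tr_in_K)
  have "Tr (b * ?v) = inverse (Tr v) * Tr (b * v)"
    using Tr_mult[OF c, of "b * v"] by (simp add: mult.left_commute)
  moreover have "Tr ?v = 1"
    using v c by (simp add: Tr_mult)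
  ultimately show ?thesis
    using v by (intro exI[of _ ?v]) simp
qed

lemma Tr_of_mem_K:
  assumes "x \<in> K"
  shows "Tr x = (if odd n then x else 0)"
proof -
  have "of_nat j * x = (if odd j then x else 0)" for j
    by (induction j) (simp_all add: distrib_right)
  then show ?thesis
    using assms by (simp add: Tr_def K_power_q_power)
qed

lemma ex_2_power_root: "\<exists>b. b ^ (2 ^ r) = (a::'a)"
proof -
  define N where "N = m * n"
  have N: "x ^ (2 ^ N) = x" for x :: 'a
    using power_card_UNIV by (simp add: q_def N_def power_mult)
  have "x ^ (2 ^ (N * i)) = x" for x :: 'a and i
    by (induction i) (simp_all add: power_add power_mult N)
  \<comment> \<open>Applying the squaring map \<open>N * r\<close> times is the identity; stopping
    \<open>r\<close> steps early gives the root. The subtraction is not truncated, since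
    \<open>N > 0\<close>.\<close>
  then have "(a ^ (2 ^ (N * r - r))) ^ (2 ^ r) = a"
    using m_pos n_pos by (simp add: N_def flip: power_mult power_add)
  then show ?thesis
    by blast
qed

section \<open>The condition from elements of trace zero\<close>

text \<open>Put \<open>w = u ^ (q - 1)\<close>. Membership of \<open>u\<close> and of
  \<open>u ^ (2 ^ r - 1)\<close> in \<open>K\<close> mean \<open>w = 1\<close> and
  \<open>w ^ (2 ^ r - 1) = 1\<close>, while \<open>w ^ ((q ^ n - 1) div (q - 1)) = 1\<close> always
  holds.\<close>

lemma power_minus_1_in_K_imp_in_K_iff:
  "(\<forall>u. u \<noteq> 0 \<and> u ^ (2 ^ r - 1) \<in> K \<longrightarrow> u \<in> K) \<longleftrightarrow>
    gcd (2 ^ r - 1) ((q ^ n - 1) div (q - 1)) = 1"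
proof -
  let ?M = "(q ^ n - 1) div (q - 1)"
  let ?g = "gcd (2 ^ r - 1) ?M"
  have "q - 1 dvd q ^ n - 1"
  proof -
    have "int q - 1 dvd int q ^ n - 1"
      using power_diff_1_eq[of "int q" n] by simp
    then have "int (q - 1) dvd int (q ^ n - 1)"
      using q_gt_1 by (simp add: of_nat_diff)
    then show ?thesis
      by simp
  qed
  then have M: "(q - 1) * ?M = q ^ n - 1"
    by simp
  have fermat: "u ^ (q ^ n - 1) = 1" if "u \<noteq> 0" for u :: 'a
    using subfield_power_card_minus_1[OF is_subfield_UNIV, of u] that card_UNIV by simp
  show ?thesis
  proof (intro iffI allI impI)
    fix u
    assume g: "?g = 1" and u: "u \<noteq> 0 \<and> u ^ (2 ^ r - 1) \<in> K"
    then have "(u ^ (q - 1)) ^ (2 ^ r - 1) = 1"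
      using mem_K_iff_power_eq_1[of "u ^ (2 ^ r - 1)"] by (simp add: mult.commute flip: power_mult)
    moreover have "(u ^ (q - 1)) ^ ?M = 1"
      using fermat[of u] u M by (simp flip: power_mult)
    ultimately have "(u ^ (q - 1)) ^ ?g = 1"
      by (rule power_gcd_eq_1)
    then show "u \<in> K"
      using g u mem_K_iff_power_eq_1[of u] by simp
  next
    assume H: "\<forall>u. u \<noteq> 0 \<and> u ^ (2 ^ r - 1) \<in> K \<longrightarrow> u \<in> K"
    \<comment> \<open>There are exactly \<open>?f\<close> solutions of \<open>x ^ ?f = 1\<close>,
      and each has its power \<open>x ^ (2 ^ r - 1)\<close> in \<open>K\<close>. They must all fit
      among the \<open>q - 1\<close> nonzero elements of \<open>K\<close>.\<close>
    let ?f = "(q - 1) * ?g"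
    have "?f dvd q ^ n - 1"
      by (metis M dvd_refl gcd_dvd2 mult_dvd_mono)
    then have "(q ^ n - 1) div ?f * ?f = card (UNIV :: 'a set) - 1"
      by (simp add: card_UNIV)
    then have card: "card {x::'a. x ^ ?f = 1} = ?f"
      using card_subfield_roots_of_unity[OF is_subfield_UNIV] by force
    have M_pos: "?M > 0"
      using M q_gt_1 n_pos by (metis mult_0_right neq0_conv one_less_power zero_less_diff less_irrefl)
    then have f_pos: "?f > 0"
      using q_gt_1 by simp
    have "{x::'a. x ^ ?f = 1} \<subseteq> K - {0}"
    proof
      fix x :: 'a
      assume x: "x \<in> {x. x ^ ?f = 1}"
      obtain h where h: "2 ^ r - 1 = ?g * h"
        by (meson dvdE gcd_dvd1)
      have "x \<noteq> 0"
        using x f_pos by (auto simp: power_0_left)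
      moreover have "(x ^ (2 ^ r - 1)) ^ (q - 1) = (x ^ ?f) ^ h"
        by (subst h) (simp add: ac_simps flip: power_mult)
      ultimately show "x \<in> K - {0}"
        using H x mem_K_iff_power_eq_1[of "x ^ (2 ^ r - 1)"] by simp
    qed
    then have "?f \<le> card (K - {0})"
      using card card_mono[of "K - {0}"] by (metis finite)
    then have "?f \<le> (q - 1) * 1"
      by (simp add: card_K)
    then have "?g \<le> 1"
      using q_gt_1 by simp
    moreover have "?g > 0"
      using M_pos by simp
    ultimately show "?g = 1"
      by linarith
  qed
qed

text \<open>For fixed \<open>c \<in> K\<close> the trace maps the additive group \<open>{v. v ^ 2 ^ r = c * v}\<close>
  to its intersection with \<open>K\<close>; if it is injective there, the group lies in \<open>K\<close>.\<close>

lemma trace_zero_power_notin_K_iff: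
  "(\<forall>u. u \<noteq> 0 \<and> Tr u = 0 \<longrightarrow> u ^ (2 ^ r - 1) \<notin> K) \<longleftrightarrow>
    odd n \<and> (\<forall>u. u \<noteq> 0 \<and> u ^ (2 ^ r - 1) \<in> K \<longrightarrow> u \<in> K)"
  (is "?A \<longleftrightarrow> _ \<and> ?H")
proof
  assume "odd n \<and> ?H"
  then show ?A
    using Tr_of_mem_K by metis
next
  assume A: ?A
  have "Tr 1 \<noteq> 0"
    using A[rule_format, of 1] by auto
  then have "odd n"
    using Tr_of_mem_K[of 1] by (auto split: if_splits)
  moreover have ?H
  proof (intro allI impI)
    fix u
    assume u: "u \<noteq> 0 \<and> u ^ (2 ^ r - 1) \<in> K"
    define c where "c = u ^ (2 ^ r - 1)"
    define V where "V = {v::'a. v ^ (2 ^ r) = c * v}"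
    have "inj_on Tr V"
    proof (rule inj_onI)
      fix v w
      assume vw: "v \<in> V" "w \<in> V" "Tr v = Tr w"
      have "(v + w) ^ (2 ^ r) = c * (v + w)"
        using vw by (simp add: V_def power_2_power_add distrib_left)
      then have "(v + w) ^ (2 ^ r - 1) * (v + w) = c * (v + w)"
        by (simp only: power_diff_1_mult zero_less_power zero_less_numeral)
      then have "v + w \<noteq> 0 \<Longrightarrow> (v + w) ^ (2 ^ r - 1) = c"
        by (metis mult_right_cancel)
      moreover have "Tr (v + w) = 0"
        using vw by (simp add: Tr_add)
      ultimately have "v + w = 0"
        using A u c_def by metis
      then show "v = w"
        by (simp add: add_eq_0_iff_eq)
    qed
    \<comment> \<open>The trace commutes with the \<open>2 ^ r\<close>-th power and, because
      \<open>c\<close> lies in \<open>K\<close>, with multiplication by \<open>c\<close>.\<close>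
    moreover have "Tr ` V \<subseteq> V \<inter> K"
    proof safe
      fix v
      assume "v \<in> V"
      then show "Tr v \<in> V"
        using u c_def by (simp add: V_def Tr_mult flip: Tr_power_2_power)
    qed (rule Tr_in_K)
    ultimately have "card V \<le> card (V \<inter> K)"
      by (intro card_inj_on_le) auto
    then have "V \<inter> K = V"
      by (intro card_seteq) auto
    moreover have "u \<in> V"
      using power_diff_1_mult[of "2 ^ r" u] by (simp add: V_def c_def)
    ultimately show "u \<in> K"
      by blast
  qed
  ultimately show "odd n \<and> ?H" ..
qed

section \<open>Injectivity through differences\<close>

lemma bij_iff:
  "bij (\<lambda>x. a * x ^ (2 ^ r) + x * Tr x) \<longleftrightarrow>
    (\<forall>u. u \<noteq> 0 \<longrightarrow> (\<nexists>x. a * u ^ (2 ^ r) + u * Tr u = x * Tr u + u * Tr x))"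
proof -
  define f where "f x = a * x ^ (2 ^ r) + x * Tr x" for x
  \<comment> \<open>Polarisation: \<open>f (x + u)\<close> is \<open>f x + f u\<close> plus a term
    additive in each of \<open>x\<close> and \<open>u\<close>.\<close>
  have diff: "f (x + u) = f x \<longleftrightarrow> f u = x * Tr u + u * Tr x" for x u
  proof -
    have "f (x + u) = f x + (f u + (x * Tr u + u * Tr x))"
      by (simp add: f_def power_2_power_add Tr_add algebra_simps del: add_self)
    then show ?thesis
      by (simp add: add_eq_0_iff_eq)
  qed
  have "bij f \<longleftrightarrow> inj f"
    using finite_UNIV_inj_surj[of f] by (auto simp: bij_def)
  also have "\<dots> \<longleftrightarrow> (\<forall>u. u \<noteq> 0 \<longrightarrow> (\<nexists>x. f (x + u) = f x))"
  proof
    assume "inj f"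
    then show "\<forall>u. u \<noteq> 0 \<longrightarrow> (\<nexists>x. f (x + u) = f x)"
      by (metis injD add_cancel_left_right)
  next
    assume *: "\<forall>u. u \<noteq> 0 \<longrightarrow> (\<nexists>x. f (x + u) = f x)"
    show "inj f"
    proof (rule injI)
      fix x y
      assume "f x = f y"
      then show "x = y"
        using * by (metis add_diff_cancel_left' diff_add_cancel add.commute right_minus_eq)
    qed
  qed
  finally show ?thesis
    unfolding diff by (simp add: f_def [abs_def])
qed

text \<open>Cancelling \<open>u\<close> leaves \<open>a * u ^ (2 ^ r - 1) = Tr x\<close>, and the
  values of the trace are exactly \<open>K\<close>.\<close>

lemma difference_zero_iff_trace_zero:
  assumes "Tr u = 0" "u \<noteq> 0"
  shows "(\<exists>x. a * u ^ (2 ^ r) + u * Tr u = x * Tr u + u * Tr x) \<longleftrightarrow> a * u ^ (2 ^ r - 1) \<in> K"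
proof -
  have "u ^ (2 ^ r) = u ^ (2 ^ r - 1) * u"
    using power_diff_1_mult[of "2 ^ r" u] by simp
  then have eq: "a * u ^ (2 ^ r) = u * (a * u ^ (2 ^ r - 1))"
    by (simp only: ac_simps)
  have "(\<exists>x. a * u ^ (2 ^ r) + u * Tr u = x * Tr u + u * Tr x) \<longleftrightarrow>
      (\<exists>x. a * u ^ (2 ^ r - 1) = Tr x)"
    unfolding eq using assms by simp
  then show ?thesis
    by (metis Tr_in_K Tr_surj)
qed

text \<open>Solvability means that the left side has trace zero: the right side has trace
  \<open>Tr x * Tr u\<close> taken twice, which vanishes.\<close>

lemma difference_zero_iff_trace_nonzero:
  assumes "Tr u \<noteq> 0"
  shows "(\<exists>x. a * u ^ (2 ^ r) + u * Tr u = x * Tr u + u * Tr x) \<longleftrightarrow>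
    Tr (a * u ^ (2 ^ r)) = (Tr u)\<^sup>2"
proof -
  let ?y = "a * u ^ (2 ^ r) + u * Tr u"
  have Tr_y: "Tr ?y = 0 \<longleftrightarrow> Tr (a * u ^ (2 ^ r)) = (Tr u)\<^sup>2"
    by (simp add: Tr_add Tr_mult' Tr_in_K add_eq_0_iff_eq power2_eq_square)
  have "(\<exists>x. ?y = x * Tr u + u * Tr x) \<longleftrightarrow> Tr ?y = 0"
  proof
    assume "\<exists>x. ?y = x * Tr u + u * Tr x"
    then obtain x where "?y = x * Tr u + u * Tr x" ..
    then show "Tr ?y = 0"
      by (simp add: Tr_add[of "x * Tr u"] Tr_mult' Tr_in_K mult.commute)
  next
    assume 0: "Tr ?y = 0"
    \<comment> \<open>The witness \<open>?y / Tr u\<close> also has trace zero, so only its term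
      \<open>x * Tr u\<close> survives.\<close>
    have "Tr (?y * inverse (Tr u)) = 0"
      using 0 by (simp only: Tr_mult' K_inverse Tr_in_K mult_zero_left)
    then show "\<exists>x. ?y = x * Tr u + u * Tr x"
      using assms by (intro exI[of _ "?y * inverse (Tr u)"]) (simp add: mult.assoc)
  qed
  then show ?thesis
    using Tr_y by simp
qed

lemma Tr_power_neq_imp_in_K:
  assumes "\<And>u. Tr u \<noteq> 0 \<Longrightarrow> Tr (a * u ^ (2 ^ r)) \<noteq> (Tr u)\<^sup>2"
  shows "a \<in> K"
proof -
  obtain b where b: "b ^ (2 ^ r) = a"
    using ex_2_power_root by blast
  have "b \<in> K"
  proof (rule ccontr)
    assume "b \<notin> K"
    \<comment> \<open>Separating with \<open>b + 1\<close> instead of \<open>b\<close> yields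
      \<open>v\<close> with \<open>Tr (b * v) = Tr v = 1\<close>, the forbidden equality.\<close>
    then have "b + 1 \<notin> K"
      using K_add[of "b + 1" 1] by (auto simp: add.assoc)
    then obtain v where v: "Tr ((b + 1) * v) = 0" "Tr v = 1"
      using ex_Tr_separating by blast
    then have "Tr (b * v) = 1"
      by (simp add: distrib_right Tr_add add_eq_0_iff_eq)
    then have "Tr (a * v ^ (2 ^ r)) = 1"
      by (simp add: Tr_power_2_power flip: b power_mult_distrib)
    then show False
      using assms[of v] v by simp
  qed
  then show ?thesis
    using K_power b by blast
qed

section \<open>The condition from elements of nonzero trace\<close>

text \<open>For \<open>l > 0\<close> the equation says that \<open>a\<close> is the power of
  \<open>inverse t\<close> with exponent \<open>2 ^ l - 2 = 2 * (2 ^ (l - 1) - 1)\<close>. The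
  factor \<open>2\<close> is prime to \<open>q - 1\<close>, so the gcd of this exponent with
  \<open>q - 1\<close> is \<open>2 ^ d - 1\<close>.\<close>

lemma twisted_square_solvable_iff:
  assumes a: "a \<in> K" "a \<noteq> 0" and d: "int d = gcd (int l - 1) (int m)"
  shows "(\<exists>t\<in>K - {0}. a * t ^ (2 ^ l) = t\<^sup>2) \<longleftrightarrow> a ^ ((q - 1) div (2 ^ d - 1)) = 1"
\<comment> \<open>For \<open>l = 0\<close> the integer \<open>l - 1\<close> is \<open>-1\<close>, so
  \<open>d = 1\<close>: the power of \<open>a\<close> is \<open>1\<close> by Fermat, and
  \<open>t = a\<close> solves the equation.\<close>
proof (cases l)
  case 0
  then have "d = 1"
    using d by simp
  then have "a ^ ((q - 1) div (2 ^ d - 1)) = 1"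
    using a mem_K_iff_power_eq_1[of a] by simp
  moreover have "a * a ^ (2 ^ l) = a\<^sup>2"
    using 0 by (simp add: power2_eq_square)
  ultimately show ?thesis
    using a by blast
next
  case (Suc j)
  let ?E = "2 * (2 ^ j - 1) :: nat"
  have "d = gcd j m"
    using d Suc by (simp add: gcd_int_int_eq)
  have "coprime 2 (2 ^ m - 1 :: nat)"
    using m_pos by simp
  then have "gcd ?E (q - 1) = gcd (2 ^ j - 1) (2 ^ m - 1)"
    by (simp add: q_def gcd_mult_left_left_cancel coprime_commute)
  also have "\<dots> = 2 ^ d - 1"
    by (simp only: gcd_two_power_minus_1 \<open>d = gcd j m\<close>)
  finally have E: "gcd ?E (q - 1) = 2 ^ d - 1" .
  have iff: "a * t ^ (2 ^ l) = t\<^sup>2 \<longleftrightarrow> inverse t ^ ?E = a" if "t \<noteq> 0" for t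
  proof -
    have "2 ^ l = ?E + 2"
      unfolding Suc power_Suc using one_le_power[of "2::nat" j] by linarith
    then have "t ^ (2 ^ l) = t ^ ?E * t\<^sup>2"
      by (simp only: power_add)
    then have "a * t ^ (2 ^ l) = t\<^sup>2 \<longleftrightarrow> a * t ^ ?E = 1"
      using that by simp
    also have "\<dots> \<longleftrightarrow> inverse t ^ ?E = a"
      using that by (auto simp: field_simps power_inverse)
    finally show ?thesis .
  qed
  have "(\<exists>t\<in>K - {0}. a * t ^ (2 ^ l) = t\<^sup>2) \<longleftrightarrow> (\<exists>t\<in>K - {0}. inverse t ^ ?E = a)"
    using iff by auto
  also have "\<dots> \<longleftrightarrow> (\<exists>t\<in>K - {0}. t ^ ?E = a)"
  proof -
    have "t \<in> K - {0} \<Longrightarrow> inverse t \<in> K - {0}" for t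
      by (simp add: K_inverse)
    then show ?thesis
      by (metis inverse_inverse_eq)
  qed
  also have "\<dots> \<longleftrightarrow> a ^ ((q - 1) div (2 ^ d - 1)) = 1"
    using subfield_power_image_iff[OF subfield a, of ?E] E by (simp add: card_K)
  finally show ?thesis .
qed

text \<open>The \<open>q ^ k\<close>-th power is trivial on \<open>K\<close>, so only the exponent
  \<open>2 ^ l\<close> remains, and \<open>t = Tr u\<close> runs through all of
  \<open>K\<close>.\<close>

lemma Tr_power_neq_iff:
  assumes "a \<in> K" and r: "r = l + m * k"
  shows "(\<forall>u. Tr u \<noteq> 0 \<longrightarrow> Tr (a * u ^ (2 ^ r)) \<noteq> (Tr u)\<^sup>2) \<longleftrightarrow>
    \<not> (\<exists>t\<in>K - {0}. a * t ^ (2 ^ l) = t\<^sup>2)"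
proof -
  have "Tr (a * u ^ (2 ^ r)) = a * Tr u ^ (2 ^ l)" for u
  proof -
    have "Tr u ^ (2 ^ r) = (Tr u ^ (2 ^ l)) ^ (q ^ k)"
      by (simp add: r q_def power_add power_mult)
    then show ?thesis
      using assms by (simp add: Tr_mult Tr_power_2_power K_power_q_power K_power Tr_in_K)
  qed
  then show ?thesis
    by (metis DiffE DiffI Tr_in_K Tr_surj singletonD singletonI)
qed

section \<open>Assembly of the criterion\<close>

theorem permutation_poly_iff:
  assumes a: "a \<noteq> 0" and d: "int d = gcd (int l - 1) (int m)"
  shows "permutation_poly (monom a (2 ^ l * q ^ k) + monom 1 1 * trace_poly q n) \<longleftrightarrow>
    odd n \<and> gcd (2 ^ (l + m * k) - 1) ((q ^ n - 1) div (q - 1)) = 1 \<and>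
    a \<in> K - {0} \<and> a ^ ((q - 1) div (2 ^ d - 1)) \<noteq> 1"
proof -
  define r where "r = l + m * k"
  define A where "A \<longleftrightarrow> (\<forall>u. u \<noteq> 0 \<and> Tr u = 0 \<longrightarrow> a * u ^ (2 ^ r - 1) \<notin> K)"
  define B where "B \<longleftrightarrow> (\<forall>u. Tr u \<noteq> 0 \<longrightarrow> Tr (a * u ^ (2 ^ r)) \<noteq> (Tr u)\<^sup>2)"
  have "2 ^ l * q ^ k = 2 ^ r"
    by (simp add: r_def q_def power_add power_mult)
  then have "poly (monom a (2 ^ l * q ^ k) + monom 1 1 * trace_poly q n) =
      (\<lambda>x. a * x ^ (2 ^ r) + x * Tr x)"
    by (auto simp: poly_monom poly_trace_poly)
  then have "permutation_poly (monom a (2 ^ l * q ^ k) + monom 1 1 * trace_poly q n) \<longleftrightarrow>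
      (\<forall>u. u \<noteq> 0 \<longrightarrow> (\<nexists>x. a * u ^ (2 ^ r) + u * Tr u = x * Tr u + u * Tr x))"
    by (simp only: permutation_poly_def bij_iff)
  \<comment> \<open>Split by whether \<open>Tr u\<close> vanishes; in \<open>B\<close> the condition
    \<open>u \<noteq> 0\<close> is implied by \<open>Tr u \<noteq> 0\<close>.\<close>
  also have "\<dots> \<longleftrightarrow> A \<and> B"
    unfolding A_def B_def
    using difference_zero_iff_trace_zero[of _ a r] difference_zero_iff_trace_nonzero[of _ a r]
    by (metis Tr_0)
  finally have "permutation_poly (monom a (2 ^ l * q ^ k) + monom 1 1 * trace_poly q n) \<longleftrightarrow> A \<and> B" .
  moreover have "a \<in> K" if B
    using that Tr_power_neq_imp_in_K unfolding B_def by blast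
  moreover have "B \<longleftrightarrow> a ^ ((q - 1) div (2 ^ d - 1)) \<noteq> 1" if "a \<in> K"
    unfolding B_def
    using Tr_power_neq_iff[OF that r_def] twisted_square_solvable_iff[OF that a d] by simp
  \<comment> \<open>A nonzero factor \<open>a\<close> from \<open>K\<close> does not affect
    membership in \<open>K\<close>, so it drops out of \<open>A\<close>.\<close>
  moreover have "A \<longleftrightarrow> odd n \<and> gcd (2 ^ r - 1) ((q ^ n - 1) div (q - 1)) = 1" if "a \<in> K"
    unfolding A_def K_mult_iff[OF that a] trace_zero_power_notin_K_iff
      power_minus_1_in_K_imp_in_K_iff ..
  ultimately show ?thesis
    using a unfolding r_def by (cases "a \<in> K") auto
qed

end

theorem corollary15:
  fixes m n k l q d :: nat
    and K :: "'a::{field,finite} set"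
    and a :: 'a
  assumes "m > 0" and "n > 0"
    and "q = 2 ^ m"
    and "card (UNIV :: 'a set) = q ^ n"
    and "is_subfield K" and "card K = q"
    and "a \<noteq> 0"
    and "int d = gcd (int l - 1) (int m)"
  shows "permutation_poly (monom a (2 ^ l * q ^ k) + monom 1 1 * trace_poly q n) \<longleftrightarrow>
    odd n \<and>
    gcd (2 ^ (l + m * k) - 1) ((q ^ n - 1) div (q - 1)) = 1 \<and>
    a \<in> K - {0} \<and> a ^ ((q - 1) div (2 ^ d - 1)) \<noteq> 1"
proof -
  interpret even_field_extension K m n q
    by unfold_locales (use assms in auto)
  show ?thesis
    using assms(7,8) by (rule permutation_poly_iff)
qed

end
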